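(* Let $(G_m)_{m\in\mathbb{Z}}$ be a generalized Fibonacci sequence and let $n\ge 0$ be an integer. Then $$\sum_{k=0}^n (-1)^k G_k G_{n-k} = - \frac{1}{2} \left(1+(-1)^n\right) \left( G_{-1} G_n - G_0 G_{n+1} \right).$$
   Context: A generalized Fibonacci sequence is a sequence $(G_m)_{m\in\mathbb{Z}}$ of complex numbers with $G_{m+2}=G_{m+1}+G_m$ for all integers $m$ (with arbitrary seed $G_0,G_1$); in particular $G_{-1}=G_1-G_0$. *)

theory Defs
  imports Complex_Main
begin

definition gen_fib :: "(int \<Rightarrow> complex) \<Rightarrow> bool" where
  "gen_fib G \<longleftrightarrow> (\<forall>m. G (m + 2) = G (m + 1) + G m)"

end

(* Writing S n for the left-hand side and A m = G 0 * G (m + 1) - G (-1) * G m, the Fibonacci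
   recurrence applied to the second factor gives S (n + 2) = S (n + 1) + S n + (-1) ^ n * A (n + 1).
   As A is again a generalized Fibonacci sequence, two-step induction yields
   S n = (1 + (-1) ^ n) / 2 * A n. *)
theory Submission
  imports Defs
begin

lemma gen_fib_alternating_convolution_rec:
  fixes G :: "int \<Rightarrow> complex" and n :: nat
  assumes "gen_fib G"
  defines "S \<equiv> \<lambda>n::nat. \<Sum>k=0..n. (-1) ^ k * G (int k) * G (int n - int k)"
  shows "S (Suc (Suc n)) = S (Suc n) + S n
           + (-1) ^ n * (G 0 * G (int n + 2) - G (-1) * G (int n + 1))"
proof -
  have rec: "G (m + 2) = G (m + 1) + G m" for m
    using assms(1) by (simp add: gen_fib_def)
  have "G (int (Suc (Suc n)) - int k) = G (int (Suc n) - int k) + G (int n - int k)" for k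
    using rec[of "int n - int k"] by (simp add: algebra_simps)
  then have "(\<Sum>k=0..n. (-1) ^ k * G (int k) * G (int (Suc (Suc n)) - int k)) =
      (\<Sum>k=0..n. (-1) ^ k * G (int k) * G (int (Suc n) - int k)) + S n"
    by (simp only: S_def distrib_left sum.distrib)
  \<comment> \<open>The terms with \<open>k > n\<close> in \<open>S (Suc n)\<close> and
    \<open>S (Suc (Suc n))\<close> leave \<open>(-1) ^ n\<close> times
    \<open>G (n + 1) * (G 0 - G 1) + G 0 * G (n + 2)\<close>, and
    \<open>G 0 - G 1 = - G (-1)\<close>.\<close>
  moreover have "G 1 = G 0 + G (-1)"
    using rec[of "-1"] by simp
  ultimately show ?thesis
    by (simp add: S_def algebra_simps)
qed

theorem mainTheorem12:
  fixes G :: "int \<Rightarrow> complex" and n :: nat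
  assumes "gen_fib G"
  shows "(\<Sum>k=0..n. (-1) ^ k * G (int k) * G (int n - int k)) =
         - (1 / 2) * (1 + (-1) ^ n) * (G (-1) * G (int n) - G 0 * G (int n + 1))"
proof (induction n rule: induct_nat_012)
  case 0
  have "G 1 = G 0 + G (-1)"
    using assms[unfolded gen_fib_def, rule_format, of "-1"] by simp
  then show ?case
    by (simp add: algebra_simps)
next
  case 1
  show ?case
    by simp
next
  case (ge2 n)
  have rec: "G (m + 2) = G (m + 1) + G m" for m
    using assms by (simp add: gen_fib_def)
  have G2: "G (int n + 2) = G (int n + 1) + G (int n)"
    by (rule rec)
  have G3: "G (int n + 3) = G (int n + 2) + G (int n + 1)"
    using rec[of "int n + 1"] by (simp add: algebra_simps)
  have idx: "int (Suc n) = int n + 1" "int (Suc (Suc n)) = int n + 2"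
    "int n + 1 + 1 = int n + 2" "int n + 2 + 1 = int n + 3"
    by simp_all
  \<comment> \<open>For even \<open>n\<close>, \<open>S (n + 1) = 0\<close> and the rest is
    \<open>A n + A (n + 1) = A (n + 2)\<close>. For odd \<open>n\<close>, \<open>S n = 0\<close> and
    the correction \<open>- A (n + 1)\<close> cancels \<open>S (n + 1)\<close>.\<close>
  show ?case
    unfolding gen_fib_alternating_convolution_rec[OF assms] ge2.IH
    unfolding idx G3 G2
    by (cases "even n") (simp_all add: algebra_simps)
qed

end
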